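(* Let $\mathcal X,\mathcal Y$ be normed vector spaces, $T:\mathcal X\to\mathcal Y$ a bounded linear operator, $y\in\mathcal Y$, $\alpha>0$, $\mathcal D\subset\mathcal X$ a nonempty convex set and $W:\mathcal D\to\mathbb R$ a functional. Assume: (1) there exists $\gamma\ge 0$ such that $W(x)\ge-\gamma$ for all $x\in\mathcal D$; (2) for every $T$-$W$-bounded sequence $\{x_n\}\subset\mathcal D$ such that $x_n$ converges weakly to some $x\in\mathcal D$, there exists a subsequence $\{x_{n_j}\}$ of $\{x_n\}$ such that $W(x)\le\liminf_{j\to\infty}W(x_{n_j})$; (3) for every $T$-$W$-bounded sequence $\{x_n\}\subset\mathcal D$ there exist a subsequence $\{x_{n_j}\}$ and $x\in\mathcal D$ such that $x_{n_j}$ converges weakly to $x$. Then the functional $J_{W,\alpha}(x)=\|Tx-y\|^2+\alpha W(x)$, $x\in\mathcal D$, has a global minimizer on $\mathcal D$. If moreover $W$ is convex and $T$ is injective, or $W$ is strictly convex, then such a minimizer is unique.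
   Context: A sequence $\{x_n\}\subset\mathcal D$ is called $T$-$W$-bounded if the sequence $\{\|Tx_n\|+W(x_n)\}$ is bounded in $\mathbb R$. Weak convergence is weak convergence in the normed space $\mathcal X$.
   Formalization: Uniqueness for convex W and injective T is stated only when the norm of Y is strictly convex; it fails otherwise: X=R, Y=R^2 with max norm, Tt=(t,0), y=(0,1), D=[-1,1], W=0 gives constant J. *)

theory Defs
  imports "HOL-Analysis.Analysis"
begin

definition weakly_converges :: "(nat \<Rightarrow> 'a::real_normed_vector) \<Rightarrow> 'a \<Rightarrow> bool" where
  "weakly_converges s x \<longleftrightarrow>
     (\<forall>f :: 'a \<Rightarrow> real. bounded_linear f \<longrightarrow> (\<lambda>n. f (s n)) \<longlonglongrightarrow> f x)"

definition TW_bounded ::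
  "('a::real_normed_vector \<Rightarrow> 'b::real_normed_vector) \<Rightarrow> ('a \<Rightarrow> real) \<Rightarrow> 'a set
     \<Rightarrow> (nat \<Rightarrow> 'a) \<Rightarrow> bool" where
  "TW_bounded T W D s \<longleftrightarrow>
     range s \<subseteq> D \<and> bounded (range (\<lambda>n. norm (T (s n)) + W (s n)))"

definition tikhonov_functional ::
  "('a::real_normed_vector \<Rightarrow> 'b::real_normed_vector) \<Rightarrow> 'b \<Rightarrow> real \<Rightarrow> ('a \<Rightarrow> real) \<Rightarrow> 'a \<Rightarrow> real" where
  "tikhonov_functional T y \<alpha> W x = (norm (T x - y))\<^sup>2 + \<alpha> * W x"

definition strictly_convex_on :: "'a::real_vector set \<Rightarrow> ('a \<Rightarrow> real) \<Rightarrow> bool" where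
  "strictly_convex_on D W \<longleftrightarrow> convex D \<and>
     (\<forall>x\<in>D. \<forall>z\<in>D. \<forall>t. x \<noteq> z \<and> 0 < t \<and> t < 1 \<longrightarrow>
        W ((1 - t) *\<^sub>R x + t *\<^sub>R z) < (1 - t) * W x + t * W z)"

text \<open>
  Strict convexity (rotundity) of the norm of the codomain. Injectivity of T together with
  convexity of W does not give uniqueness of the minimizer for a general norm: in the plane with
  the maximum norm, t \<mapsto> (t, 0) on [-1, 1] with W = 0 and y = (0, 1) has every point of
  [-1, 1] as a minimizer.
\<close>

definition strictly_convex_norm :: "'b::real_normed_vector itself \<Rightarrow> bool" where
  "strictly_convex_norm _ \<longleftrightarrow>
     (\<forall>u v :: 'b. norm u = 1 \<and> norm v = 1 \<and> u \<noteq> v \<longrightarrow> norm (u + v) < 2)"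

end

theory Submission
  imports Defs
begin

text \<open>
  Existence is the direct method of the calculus of variations. Along a minimizing sequence both
  the residual and \<open>W\<close> stay bounded, because the squared norm is nonnegative and \<open>W\<close> is bounded
  below; so the sequence is \<open>T\<close>-\<open>W\<close>-bounded and has a weakly convergent subsequence with limit in
  \<open>D\<close>. The value at the limit cannot exceed the infimum: the penalty is lower semicontinuous along
  a further subsequence by hypothesis, and the fidelity term is weakly lower semicontinuous.

  For the fidelity term, take a norming functional \<open>g\<close> for \<open>b = T x - y\<close>, that is, a linear \<open>g\<close>
  with \<open>g b = norm b\<close> and \<open>\<bar>g u\<bar> \<le> norm u\<close>. The inequality
  \<open>(norm u)\<^sup>2 \<ge> 2 * norm b * g u - (norm b)\<^sup>2\<close> bounds the squared norm from below by an affine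
  continuous functional that agrees with it at \<open>b\<close>, and \<open>g \<circ> T\<close> is one of the functionals tested by
  weak convergence (\<open>weak_minorant_of_squared_residual\<close>).

  Norming functionals come from a Hahn--Banach argument that extends nothing: by Zorn's lemma there
  is a minimal sublinear functional below a given one, and a minimal sublinear functional is linear
  (\<open>minimal_sublinear_is_linear\<close>). All functionals in sight are defined on the whole space, so no
  partial functions or subspaces appear.

  Uniqueness holds because the value at the midpoint of two different points is strictly smaller
  than the mean of the two values. The strict inequality comes from \<open>W\<close> if \<open>W\<close> is strictly
  convex, and otherwise from the squared norm, which is strictly convex when the norm is
  rotund; injectivity of \<open>T\<close> keeps the two residuals different.
\<close>

section \<open>Sublinear functionals and norming functionals\<close>

definition sublinear :: "('a::real_vector \<Rightarrow> real) \<Rightarrow> bool" where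
  "sublinear p \<longleftrightarrow>
     (\<forall>x z. p (x + z) \<le> p x + p z) \<and> (\<forall>c\<ge>0. \<forall>x. p (c *\<^sub>R x) = c * p x)"

lemma sublinear_add: "sublinear p \<Longrightarrow> p (x + z) \<le> p x + p z"
  by (simp add: sublinear_def)

lemma sublinear_scaleR: "sublinear p \<Longrightarrow> 0 \<le> c \<Longrightarrow> p (c *\<^sub>R x) = c * p x"
  by (simp add: sublinear_def)

lemma sublinear_zero: "sublinear p \<Longrightarrow> p 0 = 0"
  using sublinear_scaleR[of p 0 0] by simp

lemma sublinear_minus_le:
  assumes "sublinear p" shows "- p (- x) \<le> p x"
  using sublinear_add[OF assms, of x "- x"] sublinear_zero[OF assms] by simp

text \<open>
  Inequality suffices in the scaling law, since it can be applied to \<open>c\<close> and to \<open>1 / c\<close>.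
\<close>

lemma sublinearI:
  assumes add: "\<And>x z. p (x + z) \<le> p x + p z"
    and scale: "\<And>c x. 0 < c \<Longrightarrow> p (c *\<^sub>R x) \<le> c * p x"
    and zero: "p 0 \<le> 0"
  shows "sublinear p"
proof -
  have p0: "p 0 = 0"
    using add[of 0 0] zero by simp
  have "p (c *\<^sub>R x) = c * p x" if "0 \<le> c" for c x
  proof (cases "c = 0")
    case True
    then show ?thesis by (simp add: p0)
  next
    case False
    with that have c: "0 < c" by simp
    have "p x \<le> (1 / c) * p (c *\<^sub>R x)"
      using scale[of "1 / c" "c *\<^sub>R x"] c by simp
    then have "c * p x \<le> p (c *\<^sub>R x)"
      using c by (simp add: field_simps)
    with scale[OF c, of x] show ?thesis by simp
  qed
  with add show ?thesis by (simp add: sublinear_def)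
qed

text \<open>
  An infimum of sublinear functionals need not be subadditive. It is so for families that are
  directed in the sense of \<open>dir\<close>, which lets each index depend on the members chosen for the two
  summands. The lemma serves both for chains and for the family of shifts in
  \<open>sublinear_lowering\<close>, whose members need not be sublinear.
\<close>

lemma sublinear_INF:
  fixes p :: "'i \<Rightarrow> 'a::real_vector \<Rightarrow> real"
  assumes ne: "I \<noteq> {}"
    and bdd: "\<And>x. bdd_below ((\<lambda>i. p i x) ` I)"
    and dir: "\<And>i j x z. i \<in> I \<Longrightarrow> j \<in> I \<Longrightarrow> \<exists>k\<in>I. p k (x + z) \<le> p i x + p j z"
    and scale: "\<And>i c x. i \<in> I \<Longrightarrow> 0 < c \<Longrightarrow> \<exists>k\<in>I. p k (c *\<^sub>R x) \<le> c * p i x"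
    and zero: "\<exists>i\<in>I. p i 0 \<le> 0"
  shows "sublinear (\<lambda>x. INF i\<in>I. p i x)"
proof (rule sublinearI)
  fix x z
  have "(INF k\<in>I. p k (x + z)) - p i x \<le> (INF j\<in>I. p j z)" if i: "i \<in> I" for i
  proof (rule cINF_greatest[OF ne])
    fix j assume "j \<in> I"
    then obtain k where "k \<in> I" "p k (x + z) \<le> p i x + p j z"
      using dir i by blast
    then show "(INF k\<in>I. p k (x + z)) - p i x \<le> p j z"
      using cINF_lower[OF bdd[of "x + z"], of k] by linarith
  qed
  then have "(INF k\<in>I. p k (x + z)) - (INF j\<in>I. p j z) \<le> (INF i\<in>I. p i x)"
    by (intro cINF_greatest[OF ne]) (simp add: algebra_simps)
  then show "(INF k\<in>I. p k (x + z)) \<le> (INF i\<in>I. p i x) + (INF j\<in>I. p j z)"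
    by linarith
next
  fix c :: real and x
  assume c: "0 < c"
  have "(INF k\<in>I. p k (c *\<^sub>R x)) / c \<le> (INF i\<in>I. p i x)"
  proof (rule cINF_greatest[OF ne])
    fix i assume "i \<in> I"
    then obtain k where "k \<in> I" "p k (c *\<^sub>R x) \<le> c * p i x"
      using scale c by blast
    then have "(INF k\<in>I. p k (c *\<^sub>R x)) \<le> c * p i x"
      using cINF_lower[OF bdd[of "c *\<^sub>R x"], of k] by linarith
    then show "(INF k\<in>I. p k (c *\<^sub>R x)) / c \<le> p i x"
      using c by (simp add: field_simps)
  qed
  then show "(INF k\<in>I. p k (c *\<^sub>R x)) \<le> c * (INF i\<in>I. p i x)"
    using c by (simp add: field_simps)
next
  obtain i where "i \<in> I" "p i 0 \<le> 0" using zero by blast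
  then show "(INF i\<in>I. p i 0) \<le> 0"
    using cINF_lower[OF bdd[of 0], of i] by linarith
qed

text \<open>
  The value at \<open>- v\<close> can be pushed down to the least value \<open>- p v\<close> that sublinearity allows if
  \<open>v\<close> keeps its value. The witness \<open>inf\<^sub>t (p (x + t v) - t p v)\<close> is the largest sublinear
  functional below \<open>p\<close> with this property.
\<close>

lemma sublinear_lowering:
  assumes p: "sublinear p"
  obtains q where "sublinear q" "q \<le> p" "q (- v) \<le> - p v"
proof -
  define I where "I = {0::real..}"
  define f where "f t x = p (x + t *\<^sub>R v) - t * p v" for t x
  define q where "q = (\<lambda>x. INF t\<in>I. f t x)"
  have lower: "- p (- x) \<le> f t x" if "t \<in> I" for t x
    using sublinear_add[OF p, of "x + t *\<^sub>R v" "- x"] sublinear_scaleR[OF p, of t v] that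
    by (simp add: f_def I_def)
  have bdd: "bdd_below ((\<lambda>t. f t x) ` I)" for x
    using lower by (intro bdd_belowI2[where m = "- p (- x)"]) auto
  have q_le: "q x \<le> f t x" if "t \<in> I" for t x
    unfolding q_def using bdd that by (rule cINF_lower)
  have "sublinear q"
    unfolding q_def
  proof (rule sublinear_INF[OF _ bdd])
    fix s t :: real and x z assume st: "s \<in> I" "t \<in> I"
    have "f (s + t) (x + z) \<le> f s x + f t z"
      using sublinear_add[OF p, of "x + s *\<^sub>R v" "z + t *\<^sub>R v"]
      by (simp add: f_def algebra_simps)
    then show "\<exists>k\<in>I. f k (x + z) \<le> f s x + f t z"
      using st by (intro bexI[of _ "s + t"]) (auto simp: I_def)
  next
    fix t c :: real and x assume tc: "t \<in> I" "0 < c"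
    have "f (c * t) (c *\<^sub>R x) = c * f t x"
      using sublinear_scaleR[OF p, of c "x + t *\<^sub>R v"] tc by (simp add: f_def algebra_simps)
    then show "\<exists>k\<in>I. f k (c *\<^sub>R x) \<le> c * f t x"
      using tc by (intro bexI[of _ "c * t"]) (auto simp: I_def)
  next
    show "\<exists>t\<in>I. f t 0 \<le> 0"
      by (intro bexI[of _ 0]) (auto simp: I_def f_def sublinear_zero[OF p])
  qed (auto simp: I_def)
  moreover have "q \<le> p"
    using q_le[of 0] by (auto simp: le_fun_def I_def f_def)
  moreover have "q (- v) \<le> - p v"
    using q_le[of 1 "- v"] by (simp add: I_def f_def sublinear_zero[OF p])
  ultimately show thesis by (rule that)
qed

lemma exists_minimal_sublinear:
  assumes p: "sublinear p"
  obtains m where "sublinear m" "m \<le> p" "\<And>q. sublinear q \<Longrightarrow> q \<le> m \<Longrightarrow> q = m"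
proof -
  define A where "A = {q. sublinear q \<and> q \<le> p}"
  let ?R = "\<lambda>q r::'a \<Rightarrow> real. r \<le> q"
  have "\<exists>m\<in>A. \<forall>q\<in>A. ?R m q \<longrightarrow> q = m"
  proof (rule predicate_Zorn)
    show "partial_order_on A (relation_of ?R A)"
      by (rule partial_order_on_relation_ofI) auto
    fix C assume chain: "C \<in> Chains (relation_of ?R A)"
    then have CA: "C \<subseteq> A" and total: "\<And>q r. q \<in> C \<Longrightarrow> r \<in> C \<Longrightarrow> q \<le> r \<or> r \<le> q"
      by (auto simp: Chains_def relation_of_def)
    have subl: "sublinear q" if "q \<in> C" for q
      using that CA by (auto simp: A_def)
    have le_p: "q x \<le> p x" if "q \<in> C" for q x
      using that CA by (auto simp: A_def le_fun_def)
    show "\<exists>u\<in>A. \<forall>q\<in>C. u \<le> q"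
    proof (cases "C = {}")
      case True
      then show ?thesis using p by (auto simp: A_def)
    next
      case False
      \<comment> \<open>Sublinearity turns the upper bound \<open>p\<close> at \<open>- x\<close> into a lower bound at \<open>x\<close>.\<close>
      have bdd: "bdd_below ((\<lambda>q. q x) ` C)" for x
      proof (rule bdd_belowI2[where m = "- p (- x)"])
        fix q assume "q \<in> C"
        then show "- p (- x) \<le> q x"
          using sublinear_minus_le[OF subl, of q x] le_p[of q "- x"] by linarith
      qed
      define u where "u = (\<lambda>x. INF q\<in>C. q x)"
      have u_le: "u x \<le> q x" if "q \<in> C" for q x
        unfolding u_def using bdd that by (rule cINF_lower)
      have "sublinear u"
        unfolding u_def
      proof (rule sublinear_INF[OF False bdd])
        fix q r :: "'a \<Rightarrow> real" and x z assume qr: "q \<in> C" "r \<in> C"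
        from total[OF qr] show "\<exists>k\<in>C. k (x + z) \<le> q x + r z"
        proof
          assume "q \<le> r"
          then show ?thesis
            using sublinear_add[OF subl[OF qr(1)], of x z] qr(1)
            by (intro bexI[of _ q]) (auto simp: le_fun_def intro: order_trans)
        next
          assume "r \<le> q"
          then show ?thesis
            using sublinear_add[OF subl[OF qr(2)], of x z] qr(2)
            by (intro bexI[of _ r]) (auto simp: le_fun_def intro: order_trans)
        qed
      next
        fix q :: "'a \<Rightarrow> real" and c :: real and x assume "q \<in> C" "0 < c"
        then show "\<exists>k\<in>C. k (c *\<^sub>R x) \<le> c * q x"
          using sublinear_scaleR[OF subl, of q c x] by (intro bexI[of _ q]) auto
      next
        show "\<exists>q\<in>C. q 0 \<le> 0"
          using False sublinear_zero[OF subl] by fastforce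
      qed
      moreover have "u \<le> p"
        using False u_le le_p by (fastforce simp: le_fun_def intro: order_trans)
      ultimately show ?thesis
        using u_le by (auto simp: A_def le_fun_def)
    qed
  qed
  then obtain m where m: "m \<in> A" "\<And>q. q \<in> A \<Longrightarrow> q \<le> m \<Longrightarrow> q = m" by blast
  show thesis
    using m by (intro that[of m]) (auto simp: A_def intro: order_trans)
qed

text \<open>
  Lowering a minimal functional changes nothing, so it already satisfies \<open>m (- v) \<le> - m v\<close>. It is
  therefore odd, and an odd sublinear functional is superadditive as well as subadditive.
\<close>

lemma minimal_sublinear_is_linear:
  assumes m: "sublinear m" and min: "\<And>q. sublinear q \<Longrightarrow> q \<le> m \<Longrightarrow> q = m"
  shows "linear m"
proof -
  have odd: "m (- v) = - m v" for v
  proof -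
    obtain q where "sublinear q" "q \<le> m" "q (- v) \<le> - m v"
      using sublinear_lowering[OF m] .
    with min have "m (- v) \<le> - m v" by blast
    with sublinear_minus_le[OF m, of v] show ?thesis by linarith
  qed
  show ?thesis
  proof (rule linearI)
    fix x z
    have "m (- x + - z) \<le> m (- x) + m (- z)"
      by (rule sublinear_add[OF m])
    then have "m x + m z \<le> m (x + z)"
      using odd[of "x + z"] by (simp add: odd)
    with sublinear_add[OF m, of x z] show "m (x + z) = m x + m z" by linarith
  next
    fix c :: real and x
    show "m (c *\<^sub>R x) = c *\<^sub>R m x"
    proof (cases "0 \<le> c")
      case True
      then show ?thesis using sublinear_scaleR[OF m] by simp
    next
      case False
      then show ?thesis
        using sublinear_scaleR[OF m, of "- c" x] odd[of "c *\<^sub>R x"] by simp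
    qed
  qed
qed

text \<open>
  A linear functional below the lowering of \<open>p\<close> at \<open>b\<close> has value at most \<open>- p b\<close> at \<open>- b\<close>, hence
  touches \<open>p\<close> at \<open>b\<close>.
\<close>

lemma linear_support_of_sublinear:
  assumes p: "sublinear p"
  obtains g where "linear g" "g b = p b" "\<And>u. g u \<le> p u"
proof -
  obtain q where q: "sublinear q" "q \<le> p" "q (- b) \<le> - p b"
    using sublinear_lowering[OF p] .
  obtain g where g: "sublinear g" "g \<le> q" "\<And>r. sublinear r \<Longrightarrow> r \<le> g \<Longrightarrow> r = g"
    using exists_minimal_sublinear[OF q(1)] by blast
  have lin: "linear g"
    using minimal_sublinear_is_linear g(1,3) .
  have le: "g u \<le> p u" for u
    using g(2) q(2) by (auto simp: le_fun_def intro: order_trans)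
  have "g (- b) \<le> - p b"
    using g(2) q(3) by (auto simp: le_fun_def intro: order_trans)
  then have "p b \<le> g b"
    by (simp add: linear_neg[OF lin])
  with le[of b] have "g b = p b" by linarith
  with lin show thesis using le by (rule that)
qed

lemma exists_norming_functional:
  fixes b :: "'b::real_normed_vector"
  obtains g :: "'b \<Rightarrow> real" where "bounded_linear g" "g b = norm b" "\<And>u. g u \<le> norm u"
proof -
  have "sublinear (norm :: 'b \<Rightarrow> real)"
    by (simp add: sublinear_def norm_triangle_ineq)
  then obtain g where g: "linear g" "g b = norm b" "\<And>u. g u \<le> norm u"
    using linear_support_of_sublinear[of norm b] by blast
  have "norm (g u) \<le> norm u * 1" for u
    using g(3)[of u] g(3)[of "- u"] by (simp add: linear_neg[OF g(1)] abs_le_iff)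
  then have "bounded_linear g"
    by (intro bounded_linear_intro[where K = 1] linear_add[OF g(1)] linear_scale[OF g(1)])
  then show thesis using g(2,3) by (rule that)
qed

section \<open>Lower semicontinuity along weakly convergent sequences\<close>

lemma weakly_converges_subseq:
  assumes "weakly_converges s x" "strict_mono r"
  shows "weakly_converges (s \<circ> r) x"
  unfolding weakly_converges_def
proof (intro allI impI)
  fix f :: "'a \<Rightarrow> real" assume "bounded_linear f"
  with assms(1) have "(\<lambda>n. f (s n)) \<longlonglongrightarrow> f x"
    by (simp add: weakly_converges_def)
  from LIMSEQ_subseq_LIMSEQ[OF this assms(2)] show "(\<lambda>n. f ((s \<circ> r) n)) \<longlonglongrightarrow> f x"
    by (simp add: o_def)
qed

text \<open>
  Weak lower semicontinuity of the squared residual in a form that adds well to the limit inferior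
  of the penalty: a convergent minorant, so that no limit inferior of a sum has to be split. The
  minorant is the linearization \<open>2 * norm b * g u - (norm b)\<^sup>2\<close> of the squared norm at
  \<open>b = T x - y\<close>, with \<open>g\<close> a norming functional for \<open>b\<close>.
\<close>

lemma weak_minorant_of_squared_residual:
  fixes T :: "'a::real_normed_vector \<Rightarrow> 'b::real_normed_vector"
  assumes T: "bounded_linear T" and weak: "weakly_converges s x"
  obtains a where "\<And>n::nat. a n \<le> (norm (T (s n) - y))\<^sup>2" "a \<longlonglongrightarrow> (norm (T x - y))\<^sup>2"
proof -
  define b where "b = T x - y"
  obtain g where g: "bounded_linear g" "g b = norm b" "\<And>u. g u \<le> norm u"
    using exists_norming_functional[of b] by blast
  define a where "a n = 2 * norm b * g (T (s n) - y) - (norm b)\<^sup>2" for n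
  have "a n \<le> (norm (T (s n) - y))\<^sup>2" for n
  proof -
    let ?u = "T (s n) - y"
    have "norm b * g ?u \<le> norm b * norm ?u"
      by (intro mult_left_mono g(3)) simp
    moreover have "0 \<le> (norm ?u - norm b)\<^sup>2" by simp
    ultimately show ?thesis
      unfolding a_def by (simp add: power2_diff algebra_simps)
  qed
  moreover have "a \<longlonglongrightarrow> (norm b)\<^sup>2"
  proof -
    have "bounded_linear (\<lambda>z. g (T z))"
      using bounded_linear_compose[OF g(1) T] by simp
    with weak have "(\<lambda>n. g (T (s n))) \<longlonglongrightarrow> g (T x)"
      unfolding weakly_converges_def by blast
    then have "(\<lambda>n. 2 * norm b * (g (T (s n)) - g y) - (norm b)\<^sup>2)
        \<longlonglongrightarrow> 2 * norm b * (g (T x) - g y) - (norm b)\<^sup>2"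
      by (intro tendsto_intros)
    moreover have "g (T x) - g y = norm b"
      using g(2) by (simp add: b_def linear_diff[OF bounded_linear.linear[OF g(1)]])
    ultimately show ?thesis
      by (simp add: a_def[abs_def] linear_diff[OF bounded_linear.linear[OF g(1)]] power2_eq_square)
  qed
  ultimately show thesis
    unfolding b_def by (rule that)
qed

text \<open>
  The hypothesis on the limit inferior is used in the form that every \<open>c < W x\<close> is eventually a
  lower bound of \<open>W (s n)\<close>; the constant \<open>c\<close> tends to \<open>W x\<close> only after the limit in \<open>n\<close>.
\<close>

lemma tikhonov_le_weak_limit:
  assumes T: "bounded_linear T" and \<alpha>: "0 < \<alpha>"
    and weak: "weakly_converges s x"
    and lsc: "ereal (W x) \<le> liminf (\<lambda>n. ereal (W (s n)))"
    and lim: "(\<lambda>n. tikhonov_functional T y \<alpha> W (s n)) \<longlonglongrightarrow> m"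
  shows "tikhonov_functional T y \<alpha> W x \<le> m"
proof -
  obtain a where a: "\<And>n. a n \<le> (norm (T (s n) - y))\<^sup>2" "a \<longlonglongrightarrow> (norm (T x - y))\<^sup>2"
    using weak_minorant_of_squared_residual[OF T weak] by blast
  have below: "(norm (T x - y))\<^sup>2 + \<alpha> * c \<le> m" if "c < W x" for c
  proof (rule LIMSEQ_le)
    show "(\<lambda>n. a n + \<alpha> * c) \<longlonglongrightarrow> (norm (T x - y))\<^sup>2 + \<alpha> * c"
      by (intro tendsto_intros a(2))
    show "(\<lambda>n. tikhonov_functional T y \<alpha> W (s n)) \<longlonglongrightarrow> m"
      by (rule lim)
    have "\<forall>\<^sub>F n in sequentially. ereal c < ereal (W (s n))"
      using lsc that unfolding le_Liminf_iff by (auto dest: spec[of _ "ereal c"])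
    then obtain N where N: "\<And>n. n \<ge> N \<Longrightarrow> c < W (s n)"
      by (auto simp: eventually_sequentially)
    have "a n + \<alpha> * c \<le> tikhonov_functional T y \<alpha> W (s n)" if "n \<ge> N" for n
      unfolding tikhonov_functional_def using a(1)[of n] N[OF that] \<alpha>
      by (intro add_mono mult_left_mono) auto
    then show "\<exists>N. \<forall>n\<ge>N. a n + \<alpha> * c \<le> tikhonov_functional T y \<alpha> W (s n)" by blast
  qed
  have "W x \<le> (m - (norm (T x - y))\<^sup>2) / \<alpha>"
  proof (rule dense_le)
    fix c assume "c < W x"
    then show "c \<le> (m - (norm (T x - y))\<^sup>2) / \<alpha>"
      using below[of c] \<alpha> by (simp add: field_simps)
  qed
  then show ?thesis
    using \<alpha> by (simp add: tikhonov_functional_def field_simps)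
qed

section \<open>Existence by the direct method\<close>

text \<open>
  Coercivity: both terms of the functional are bounded below, so a bound on their sum bounds each
  of them.
\<close>

lemma TW_bounded_if_tikhonov_bounded:
  assumes \<alpha>: "0 < \<alpha>" and W: "\<And>x. x \<in> D \<Longrightarrow> - \<gamma> \<le> W x"
    and s: "\<And>n. s n \<in> D" and B: "\<And>n. tikhonov_functional T y \<alpha> W (s n) \<le> B"
  shows "TW_bounded T W D s"
proof -
  define K where "K = B + \<alpha> * \<gamma>"
  have upper: "norm (T (s n)) + W (s n) \<le> K + 1 + norm y + B / \<alpha>" for n
  proof -
    let ?u = "T (s n) - y"
    have J: "(norm ?u)\<^sup>2 + \<alpha> * W (s n) \<le> B"
      using B[of n] by (simp add: tikhonov_functional_def)
    have "\<alpha> * - \<gamma> \<le> \<alpha> * W (s n)"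
      using W[OF s[of n]] \<alpha> by (intro mult_left_mono) auto
    with J have "(norm ?u)\<^sup>2 \<le> K" by (simp add: K_def)
    \<comment> \<open>A bound on the norm from its square, without roots: \<open>2 * norm u \<le> (norm u)\<^sup>2 + 1\<close>.\<close>
    moreover have "0 \<le> (norm ?u - 1)\<^sup>2" "0 \<le> norm ?u" by simp_all
    ultimately have "norm ?u \<le> K + 1" unfolding power2_diff one_power2 mult_1_right by linarith
    moreover have "norm (T (s n)) \<le> norm ?u + norm y"
      using norm_triangle_ineq[of ?u y] by simp
    moreover have "\<alpha> * W (s n) \<le> B"
      using J zero_le_power2[of "norm ?u"] by linarith
    then have "W (s n) \<le> B / \<alpha>"
      using \<alpha> by (simp add: field_simps)
    ultimately show ?thesis by linarith
  qed
  have lower: "- \<gamma> \<le> norm (T (s n)) + W (s n)" for n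
    using W[OF s[of n]] norm_ge_zero[of "T (s n)"] by linarith
  have "bounded (range (\<lambda>n. norm (T (s n)) + W (s n)))"
  proof (rule bounded_subset[OF bounded_closed_interval])
    show "range (\<lambda>n. norm (T (s n)) + W (s n)) \<subseteq> {- \<gamma> .. K + 1 + norm y + B / \<alpha>}"
      using upper lower by auto
  qed
  with s show ?thesis by (auto simp: TW_bounded_def)
qed

lemma exists_minimizing_sequence:
  fixes J :: "'a \<Rightarrow> real"
  assumes ne: "D \<noteq> {}" and bdd: "bdd_below (J ` D)"
  obtains s :: "nat \<Rightarrow> 'a" where "\<And>n. s n \<in> D" "(\<lambda>n. J (s n)) \<longlonglongrightarrow> (INF x\<in>D. J x)"
proof -
  have "(INF x\<in>D. J x) \<in> closure (J ` D)"
    using ne bdd by (intro closure_contains_Inf) auto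
  then obtain t where t: "\<And>n. t n \<in> J ` D" "t \<longlonglongrightarrow> (INF x\<in>D. J x)"
    by (auto simp: closure_sequential)
  from t(1) have "\<exists>x\<in>D. J x = t n" for n by (metis imageE)
  then obtain s where s: "\<And>n. s n \<in> D" "\<And>n. J (s n) = t n" by metis
  with t(2) show thesis by (intro that[of s]) auto
qed

lemma exists_tikhonov_minimizer:
  fixes T :: "'a::real_normed_vector \<Rightarrow> 'b::real_normed_vector"
  assumes T: "bounded_linear T" and \<alpha>: "0 < \<alpha>" and ne: "D \<noteq> {}"
    and W: "\<And>x. x \<in> D \<Longrightarrow> - \<gamma> \<le> W x"
    and lsc: "\<And>s x. TW_bounded T W D s \<Longrightarrow> x \<in> D \<Longrightarrow> weakly_converges s x \<Longrightarrow>
           \<exists>r :: nat \<Rightarrow> nat. strict_mono r \<and> ereal (W x) \<le> liminf (\<lambda>j. ereal (W (s (r j))))"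
    and compact: "\<And>s. TW_bounded T W D s \<Longrightarrow>
           \<exists>r :: nat \<Rightarrow> nat. \<exists>x\<in>D. strict_mono r \<and> weakly_converges (s \<circ> r) x"
  shows "\<exists>x. is_arg_min (tikhonov_functional T y \<alpha> W) (\<lambda>x. x \<in> D) x"
proof -
  let ?J = "tikhonov_functional T y \<alpha> W"
  have "- (\<alpha> * \<gamma>) \<le> ?J x" if "x \<in> D" for x
  proof -
    have "\<alpha> * - \<gamma> \<le> \<alpha> * W x"
      using W[OF that] \<alpha> by (intro mult_left_mono) auto
    then show ?thesis
      using zero_le_power2[of "norm (T x - y)"] unfolding tikhonov_functional_def by linarith
  qed
  then have bdd: "bdd_below (?J ` D)"
    by (rule bdd_belowI2)
  obtain s where s: "\<And>n. s n \<in> D" "(\<lambda>n. ?J (s n)) \<longlonglongrightarrow> (INF x\<in>D. ?J x)"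
    using exists_minimizing_sequence[OF ne bdd] by blast
  obtain B where "\<And>n. \<bar>?J (s n)\<bar> \<le> B"
    using convergent_imp_Bseq[OF convergentI[OF s(2)]] by (auto simp: Bseq_def)
  then have B: "\<And>n. ?J (s n) \<le> B" by (auto simp: abs_le_iff)
  have TW: "TW_bounded T W D (s \<circ> r)" for r
    using TW_bounded_if_tikhonov_bounded[OF \<alpha> W, where s = "s \<circ> r" and y = y and B = B] s(1) B by simp
  obtain r x where r: "x \<in> D" "strict_mono r" "weakly_converges (s \<circ> r) x"
    using compact[OF TW[of id]] by auto
  obtain r' where r': "strict_mono r'" "ereal (W x) \<le> liminf (\<lambda>j. ereal (W ((s \<circ> r) (r' j))))"
    using lsc[OF TW r(1,3)] by blast
  have "?J x \<le> (INF x\<in>D. ?J x)"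
  proof (rule tikhonov_le_weak_limit[OF T \<alpha>])
    show "weakly_converges (s \<circ> r \<circ> r') x"
      using weakly_converges_subseq r(3) r'(1) .
    show "ereal (W x) \<le> liminf (\<lambda>n. ereal (W ((s \<circ> r \<circ> r') n)))"
      using r'(2) by simp
    show "(\<lambda>n. ?J ((s \<circ> r \<circ> r') n)) \<longlonglongrightarrow> (INF x\<in>D. ?J x)"
      using LIMSEQ_subseq_LIMSEQ[OF s(2) strict_mono_o[OF r(2) r'(1)]] by (simp add: o_def)
  qed
  then have "?J x \<le> ?J z" if "z \<in> D" for z
    using cINF_lower[OF bdd that] by linarith
  with r(1) show ?thesis
    by (auto simp: is_arg_min_linorder)
qed

section \<open>Uniqueness by midpoint convexity\<close>

lemma norm_half_squared:
  fixes w :: "'b::real_normed_vector"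
  shows "(norm ((1/2) *\<^sub>R w))\<^sup>2 = (norm w)\<^sup>2 / 4"
  by (simp add: power_divide)

lemma norm_midpoint_squared_le:
  fixes u v :: "'b::real_normed_vector"
  shows "(norm ((1/2) *\<^sub>R (u + v)))\<^sup>2 \<le> ((norm u)\<^sup>2 + (norm v)\<^sup>2) / 2"
proof -
  have "(norm (u + v))\<^sup>2 \<le> (norm u + norm v)\<^sup>2"
    by (intro power_mono norm_triangle_ineq) simp
  moreover have "0 \<le> (norm u - norm v)\<^sup>2" by simp
  ultimately show ?thesis
    unfolding norm_half_squared power2_sum power2_diff by simp
qed

text \<open>
  If the norms of \<open>u\<close> and \<open>v\<close> differ, the square function is strict; if they agree, rotundity
  is strict, after rescaling to the unit sphere.
\<close>

lemma norm_midpoint_squared_less: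
  fixes u v :: "'b::real_normed_vector"
  assumes rotund: "strictly_convex_norm TYPE('b)" and ne: "u \<noteq> v"
  shows "(norm ((1/2) *\<^sub>R (u + v)))\<^sup>2 < ((norm u)\<^sup>2 + (norm v)\<^sup>2) / 2"
proof (cases "norm u = norm v")
  case False
  have "(norm (u + v))\<^sup>2 \<le> (norm u + norm v)\<^sup>2"
    by (intro power_mono norm_triangle_ineq) simp
  moreover have "0 < (norm u - norm v)\<^sup>2" using False by simp
  ultimately show ?thesis
    unfolding norm_half_squared power2_sum power2_diff by simp
next
  case True
  define a where "a = norm u"
  have a: "0 < a"
    using True ne by (auto simp: a_def)
  have "norm ((1/a) *\<^sub>R u + (1/a) *\<^sub>R v) < 2"
    using rotund a ne True unfolding strictly_convex_norm_def by (auto simp: a_def)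
  then have "norm (u + v) / a < 2"
    using a by (simp add: scaleR_add_right[symmetric])
  then have "norm (u + v) < 2 * a"
    using a by (simp add: field_simps)
  then have "(norm (u + v))\<^sup>2 < (2 * a)\<^sup>2"
    by (intro power_strict_mono) auto
  then show ?thesis
    using True unfolding norm_half_squared by (simp add: a_def power_mult_distrib)
qed

lemma arg_min_unique_if_midpoint_less:
  fixes J :: "'a::real_vector \<Rightarrow> real"
  assumes D: "convex D"
    and mid: "\<And>x z. x \<in> D \<Longrightarrow> z \<in> D \<Longrightarrow> x \<noteq> z \<Longrightarrow> J ((1/2) *\<^sub>R (x + z)) < (J x + J z) / 2"
    and x: "is_arg_min J (\<lambda>x. x \<in> D) x" and z: "is_arg_min J (\<lambda>x. x \<in> D) z"
  shows "x = z"
proof (rule ccontr)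
  assume ne: "x \<noteq> z"
  have xz: "x \<in> D" "z \<in> D"
    using x z by (auto simp: is_arg_min_def)
  let ?c = "(1/2) *\<^sub>R (x + z)"
  have "?c \<in> D"
    using convexD[OF D xz, of "1/2" "1/2"] by (simp add: scaleR_add_right)
  then have "J x \<le> J ?c" "J z \<le> J ?c"
    using x z by (auto simp: is_arg_min_linorder)
  with mid[OF xz ne] show False by simp
qed

lemma tikhonov_midpoint_less:
  fixes T :: "'a::real_normed_vector \<Rightarrow> 'b::real_normed_vector"
  assumes T: "bounded_linear T" and \<alpha>: "0 < \<alpha>"
    and conv: "convex_on D W \<and> inj T \<and> strictly_convex_norm TYPE('b) \<or> strictly_convex_on D W"
    and xz: "x \<in> D" "z \<in> D" "x \<noteq> z"
  shows "tikhonov_functional T y \<alpha> W ((1/2) *\<^sub>R (x + z)) <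
    (tikhonov_functional T y \<alpha> W x + tikhonov_functional T y \<alpha> W z) / 2"
proof -
  let ?c = "(1/2) *\<^sub>R (x + z)" and ?u = "T x - y" and ?v = "T z - y"
  have lin: "linear T" using T by (rule bounded_linear.linear)
  have "(1/2) *\<^sub>R y + (1/2) *\<^sub>R y = y"
    by (simp add: scaleR_add_left[symmetric])
  then have res: "T ?c - y = (1/2) *\<^sub>R (?u + ?v)"
    by (simp add: linear_add[OF lin] linear_scale[OF lin] algebra_simps)
  from conv show ?thesis
  proof
    assume *: "convex_on D W \<and> inj T \<and> strictly_convex_norm TYPE('b)"
    then have "W ((1/2) *\<^sub>R x + (1/2) *\<^sub>R z) \<le> (1/2) * W x + (1/2) * W z"
      using convex_onD[of D W "1/2" x z] xz by simp
    then have "\<alpha> * W ?c \<le> \<alpha> * ((W x + W z) / 2)"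
      using \<alpha> by (intro mult_left_mono) (auto simp: scaleR_add_right)
    moreover have "?u \<noteq> ?v"
      using * xz(3) by (auto dest: injD)
    then have "(norm (T ?c - y))\<^sup>2 < ((norm ?u)\<^sup>2 + (norm ?v)\<^sup>2) / 2"
      unfolding res using * by (intro norm_midpoint_squared_less) auto
    ultimately show ?thesis
      unfolding tikhonov_functional_def by (simp add: field_simps)
  next
    assume "strictly_convex_on D W"
    then have "W ((1 - 1/2) *\<^sub>R x + (1/2) *\<^sub>R z) < (1 - 1/2) * W x + (1/2) * W z"
      using xz unfolding strictly_convex_on_def
      by (metis half_gt_zero_iff zero_less_one field_sum_of_halves less_add_same_cancel1)
    then have "\<alpha> * W ?c < \<alpha> * ((W x + W z) / 2)"
      using \<alpha> by (intro mult_strict_left_mono) (auto simp: scaleR_add_right)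
    moreover have "(norm (T ?c - y))\<^sup>2 \<le> ((norm ?u)\<^sup>2 + (norm ?v)\<^sup>2) / 2"
      unfolding res by (rule norm_midpoint_squared_le)
    ultimately show ?thesis
      unfolding tikhonov_functional_def by (simp add: field_simps)
  qed
qed

section \<open>Existence and uniqueness of the regularized solution\<close>

theorem theorem2p9:
  fixes T :: "'a::real_normed_vector \<Rightarrow> 'b::real_normed_vector"
    and y :: 'b and \<alpha> :: real and D :: "'a set" and W :: "'a \<Rightarrow> real"
  assumes "bounded_linear T"
    and "\<alpha> > 0"
    and "D \<noteq> {}" and "convex D"
    and "\<exists>\<gamma>\<ge>0. \<forall>x\<in>D. W x \<ge> - \<gamma>"
    and "\<And>s x. TW_bounded T W D s \<Longrightarrow> x \<in> D \<Longrightarrow> weakly_converges s x \<Longrightarrow>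
           \<exists>r :: nat \<Rightarrow> nat. strict_mono r \<and> ereal (W x) \<le> liminf (\<lambda>j. ereal (W (s (r j))))"
    and "\<And>s. TW_bounded T W D s \<Longrightarrow>
           \<exists>r :: nat \<Rightarrow> nat. \<exists>x\<in>D. strict_mono r \<and> weakly_converges (s \<circ> r) x"
  shows "(\<exists>x. is_arg_min (tikhonov_functional T y \<alpha> W) (\<lambda>x. x \<in> D) x) \<and>
    (convex_on D W \<and> inj T \<and> strictly_convex_norm TYPE('b) \<or> strictly_convex_on D W \<longrightarrow>
       (\<exists>!x. is_arg_min (tikhonov_functional T y \<alpha> W) (\<lambda>x. x \<in> D) x))"
proof -
  let ?J = "tikhonov_functional T y \<alpha> W"
  obtain \<gamma> where \<gamma>: "\<And>x. x \<in> D \<Longrightarrow> - \<gamma> \<le> W x"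
    using assms(5) by blast
  have ex: "\<exists>x. is_arg_min ?J (\<lambda>x. x \<in> D) x"
    using exists_tikhonov_minimizer[OF assms(1-3) \<gamma> assms(6,7)] .
  moreover have "\<exists>!x. is_arg_min ?J (\<lambda>x. x \<in> D) x"
    if conv: "convex_on D W \<and> inj T \<and> strictly_convex_norm TYPE('b) \<or> strictly_convex_on D W"
  proof -
    have "x = z" if "is_arg_min ?J (\<lambda>x. x \<in> D) x" "is_arg_min ?J (\<lambda>x. x \<in> D) z" for x z
      using assms(4) tikhonov_midpoint_less[OF assms(1,2) conv] that
      by (rule arg_min_unique_if_midpoint_less)
    with ex show ?thesis by blast
  qed
  ultimately show ?thesis by blast
qed

end
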